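(* There is an absolute constant $C>0$ such that for all integers $n\ge2$ and $d\ge2$ the following holds. Let $\mathcal{H}_n=\{\mu\in\mathbb{Z}_{+}^d : \|\mu\|_1=n\}$ be the collection of all $n$-histograms over a domain of size $d$. Then there exist a positive integer $m\le C\,\dfrac{n\log d}{\log n}$ and a matrix $S\in\{0,1\}^{m\times d}$ such that $$\forall\,\mu_1,\mu_2\in\mathcal{H}_n:\qquad \mu_1\ne\mu_2\ \Longrightarrow\ S\mu_1\ne S\mu_2 .$$
   Context: $\mathbb{Z}_+$ denotes the nonnegative integers, and $S\mu$ is the matrix-vector product over the integers. *)

theory Defs
  imports Complex_Main "Jordan_Normal_Form.Matrix"
begin

definition l1_norm :: "int vec \<Rightarrow> int" where
  "l1_norm v = (\<Sum>i<dim_vec v. \<bar>v $ i\<bar>)"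

definition histograms :: "nat \<Rightarrow> nat \<Rightarrow> int vec set" where
  "histograms n d =
     {\<mu> \<in> carrier_vec d. (\<forall>i<d. 0 \<le> \<mu> $ i) \<and> l1_norm \<mu> = int n}"

definition binary_mats :: "nat \<Rightarrow> nat \<Rightarrow> int mat set" where
  "binary_mats m d = {S \<in> carrier_mat m d. \<forall>i<m. \<forall>j<d. S $$ (i, j) \<in> {0, 1}}"

end

theory Submission
  imports Defs "HOL-Combinatorics.Multiset_Permutations"
begin

text \<open>
  Choose the rows of \<open>S\<close> as independent uniformly random subsets of the domain and take a union bound over
  the differences \<open>v = \<mu>1 - \<mu>2 \<noteq> 0\<close>. By the Littlewood-Offord theorem (deduced from Sperner's theorem)
  a random row annihilates a \<open>v\<close> of support size \<open>k\<close> with probability at most \<open>1 / sqrt (k + 1)\<close>.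
  The at most \<open>d ^ (2 * n)\<close> differences with \<open>k > sqrt n\<close> each survive \<open>m\<close> rows with probability
  at most \<open>n powr (- m / 4)\<close>; those with \<open>k \<le> sqrt n\<close> are so few, at most
  \<open>(d * (2 * n + 1)) powr sqrt n\<close>, that the trivial gain \<open>1 / sqrt 2\<close> per row suffices.
\<close>

section \<open>Sperner's theorem\<close>

text \<open>
  Sperner's theorem, by the LYM argument: the orderings of \<open>K\<close> that begin with an ordering of \<open>A\<close> are
  disjoint for different members \<open>A\<close> of an antichain.
\<close>
lemma card_antichain_le_central_binomial:
  assumes "finite K" and F: "F \<subseteq> Pow K"
    and anti: "\<And>A B. A \<in> F \<Longrightarrow> B \<in> F \<Longrightarrow> A \<subseteq> B \<Longrightarrow> A = B"
  shows "card F \<le> card K choose (card K div 2)"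
proof -
  define k where "k = card K"
  define P where "P A = (\<lambda>(xs, ys). xs @ ys) ` (permutations_of_set A \<times> permutations_of_set (K - A))"
    for A :: "'a set"
  have finF: "finite F"
    using F \<open>finite K\<close> by (meson finite_Pow_iff finite_subset)
  have card_P: "card (P A) = fact (card A) * fact (k - card A)" if "A \<in> F" for A
  proof -
    have A: "A \<subseteq> K" "finite A"
      using that F \<open>finite K\<close> by (auto intro: finite_subset)
    \<comment> \<open>All orderings of \<open>A\<close> have the same length, so the cut point of
      \<open>xs @ ys\<close> is known.\<close>
    have "inj_on (\<lambda>(xs, ys). xs @ ys) (permutations_of_set A \<times> permutations_of_set (K - A))"
      by (auto simp: inj_on_def dest!: length_finite_permutations_of_set)
    then show ?thesis
      using A \<open>finite K\<close>
      by (simp add: P_def card_image card_cartesian_product card_Diff_subset k_def)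
  qed
  have disj: "P A \<inter> P B = {}" if "A \<in> F" "B \<in> F" "A \<noteq> B" for A B
  proof (rule ccontr)
    assume "P A \<inter> P B \<noteq> {}"
    then obtain xs ys xs' ys' where eq: "xs @ ys = xs' @ ys'"
      and s: "set xs = A" "set xs' = B"
      by (auto simp: P_def permutations_of_set_def)
    \<comment> \<open>Of two prefixes of the same list, one is a prefix of the other.\<close>
    have "A \<subseteq> B \<or> B \<subseteq> A"
      using eq s by (auto simp: append_eq_append_conv2)
    then show False
      using anti that by blast
  qed
  have "(\<Union>A\<in>F. P A) \<subseteq> permutations_of_set K"
    using F by (fastforce simp: P_def permutations_of_set_def)
  then have "card (\<Union>A\<in>F. P A) \<le> fact k"
    using card_mono[of "permutations_of_set K"] \<open>finite K\<close> by (fastforce simp: k_def)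
  moreover have "card (\<Union>A\<in>F. P A) = (\<Sum>A\<in>F. card (P A))"
    using finF disj by (intro card_UN_disjoint) (auto simp: P_def)
  ultimately have sum_le: "(\<Sum>A\<in>F. card (P A)) \<le> fact k"
    by simp
  \<comment> \<open>Each block \<open>P A\<close> fills a fraction 1 /
    (\<open>k choose card A\<close>) of all orderings, which is smallest for the middle
    layer.\<close>
  have "fact k \<le> (k choose (k div 2)) * card (P A)" if "A \<in> F" for A
  proof -
    have "card A \<le> k"
      using that F \<open>finite K\<close> by (auto simp: k_def intro: card_mono)
    then have "fact k = (k choose card A) * card (P A)"
      using binomial_fact_lemma[of "card A" k] card_P[OF that] by (simp add: mult.commute)
    also have "\<dots> \<le> (k choose (k div 2)) * card (P A)"
      by (intro mult_right_mono binomial_maximum) auto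
    finally show ?thesis .
  qed
  then have "card F * fact k \<le> (\<Sum>A\<in>F. (k choose (k div 2)) * card (P A))"
    using sum_bounded_below[of F "fact k" "\<lambda>A. (k choose (k div 2)) * card (P A)"] by simp
  also have "\<dots> \<le> (k choose (k div 2)) * fact k"
    using sum_le by (simp flip: sum_distrib_left)
  finally show ?thesis
    by (simp add: k_def)
qed

section \<open>Bounds for central binomial coefficients\<close>

text \<open>Consecutive central binomials have ratio 2 (2 n + 1) / (n + 1), so the left side divided
  by \<open>16 ^ n\<close> does not increase with \<open>n\<close>; it is 1 at
  \<open>n = 0\<close>.\<close>

lemma even_central_binomial_sq_le: "((2 * n) choose n)\<^sup>2 * (2 * n + 1) \<le> (16::nat) ^ n"
proof (induction n)
  case 0
  then show ?case by simp
next
  case (Suc n)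
  define c where "c = (2 * n) choose n"
  define c' where "c' = (2 * Suc n) choose (Suc n)"
  have "Suc n * c' = 2 * ((2 * n + 1) * c)"
  proof -
    have 1: "Suc n * c' = (2 * n + 2) * ((2 * n + 1) choose n)"
      using Suc_times_binomial[of n "2 * n + 1"] by (simp add: c'_def)
    have "(2 * n + 1) choose n = (2 * n + 1) choose (Suc n)"
      using binomial_symmetric[of n "2 * n + 1"] by simp
    then have "Suc n * ((2 * n + 1) choose n) = (2 * n + 1) * c"
      using Suc_times_binomial[of n "2 * n"] by (simp add: c_def)
    with 1 show ?thesis
      by (simp add: algebra_simps)
  qed
  \<comment> \<open>The factor \<open>(Suc n)\<^sup>2\<close> avoids division and is cancelled at
    the end.\<close>
  then have "(Suc n)\<^sup>2 * (c'\<^sup>2 * (2 * Suc n + 1)) = (2 * ((2 * n + 1) * c))\<^sup>2 * (2 * Suc n + 1)"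
    by (simp only: power_mult_distrib[symmetric] mult.assoc[symmetric])
  also have "\<dots> = 4 * ((2 * n + 1) * (2 * Suc n + 1)) * (c\<^sup>2 * (2 * n + 1))"
  proof -
    have "(2 * (a * c))\<^sup>2 * b = 4 * (a * b) * (c\<^sup>2 * a)" for a b :: nat
      by (simp add: power2_eq_square)
    then show ?thesis by blast
  qed
  also have "\<dots> \<le> 4 * (4 * (Suc n)\<^sup>2) * 16 ^ n"
  proof -
    \<comment> \<open>The two factors lie at distance 1 on either side of
      \<open>2 * Suc n\<close>.\<close>
    have "(2 * n + 1) * (2 * Suc n + 1) \<le> 4 * (Suc n)\<^sup>2"
      by (simp add: power2_eq_square)
    then show ?thesis
      using Suc.IH unfolding c_def by (rule mult_le_mono[OF mult_le_mono2])
  qed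
  also have "4 * (4 * a) * b = a * (16 * b)" for a b :: nat
    by simp
  finally have "c'\<^sup>2 * (2 * Suc n + 1) \<le> 16 * 16 ^ n"
    by (subst (asm) mult_le_cancel1) simp
  then show ?case
    unfolding c'_def by simp
qed

text \<open>Odd \<open>k\<close> reduces to the even number \<open>k + 1\<close>, whose central
  binomial is exactly twice that of \<open>k\<close>.\<close>

lemma central_binomial_sq_le: "(k choose (k div 2))\<^sup>2 * (k + 1) \<le> (4::nat) ^ k"
proof (cases "even k")
  case True
  then obtain n where "k = 2 * n" by (elim evenE)
  then show ?thesis
    using even_central_binomial_sq_le[of n] by (simp add: power_mult)
next
  case False
  then obtain n where k: "k = 2 * n + 1" by (elim oddE)
  have "(2 * Suc n) choose Suc n = 2 * (k choose n)"
    using binomial_symmetric[of n "2 * n + 1"] by (simp add: k)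
  then have "4 * ((k choose n)\<^sup>2 * (2 * n + 3)) \<le> 16 ^ Suc n"
    using even_central_binomial_sq_le[of "Suc n"]
    by (simp add: power2_eq_square algebra_simps)
  then have "(k choose n)\<^sup>2 * (2 * n + 3) \<le> 4 ^ k"
    using power_mult[of "4::nat" 2 n] by (simp add: k mult_ac)
  moreover have "(k choose n)\<^sup>2 * (k + 1) \<le> (k choose n)\<^sup>2 * (2 * n + 3)"
    unfolding k by (intro mult_left_mono) auto
  ultimately show ?thesis
    by (simp add: k)
qed

section \<open>Littlewood-Offord theorem\<close>

text \<open>
  Complementing the subsets on the indices where \<open>v\<close> is negative replaces \<open>v\<close> by \<open>\<bar>v\<bar>\<close>, which turns
  the subsets of equal sum into an antichain.
\<close>
lemma littlewood_offord:
  fixes v :: "'a \<Rightarrow> 'b::linordered_idom"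
  assumes "finite K" and nz: "\<And>i. i \<in> K \<Longrightarrow> v i \<noteq> 0"
  shows "card {A. A \<subseteq> K \<and> sum v A = t} \<le> card K choose (card K div 2)"
proof -
  define N where "N = {i \<in> K. v i < 0}"
  define flip where "flip A = (A - N) \<union> (N - A)" for A
  let ?F = "{A. A \<subseteq> K \<and> sum v A = t}"
  have "flip (flip A) = A" for A
    by (auto simp: flip_def)
  then have inj: "inj_on flip ?F"
    by (metis inj_onI)
  have flip_K: "flip A \<subseteq> K" if "A \<subseteq> K" for A
    using that by (auto simp: flip_def N_def)
  \<comment> \<open>An index of \<open>N\<close> contributes \<open>\<bar>v i\<bar>\<close> after
    the flip iff it was absent before, that is, \<open>v i + \<bar>v i\<bar> = 0\<close> if present
    and \<open>0 + \<bar>v i\<bar>\<close> if absent. Hence the shift does not depend on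
    \<open>A\<close>.\<close>
  have sum_flip: "(\<Sum>i\<in>flip A. \<bar>v i\<bar>) = sum v A + (\<Sum>i\<in>N. \<bar>v i\<bar>)" if "A \<subseteq> K" for A
  proof -
    have *: "sum f B = (\<Sum>i\<in>K. if i \<in> B then f i else 0)" if "B \<subseteq> K" for B and f :: "'a \<Rightarrow> 'b"
      using that \<open>finite K\<close> by (intro sum.mono_neutral_cong_left) auto
    have "N \<subseteq> K" by (auto simp: N_def)
    then show ?thesis
      unfolding *[OF flip_K[OF that]] *[OF that] *[OF \<open>N \<subseteq> K\<close>] sum.distrib[symmetric]
      using that by (intro sum.cong) (auto simp: flip_def N_def)
  qed
  have "card (flip ` ?F) \<le> card K choose (card K div 2)"
  proof (rule card_antichain_le_central_binomial)
    show "flip ` ?F \<subseteq> Pow K"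
      using flip_K by blast
    fix X Y assume "X \<in> flip ` ?F" "Y \<in> flip ` ?F" and "X \<subseteq> Y"
    then have eq: "(\<Sum>i\<in>X. \<bar>v i\<bar>) = (\<Sum>i\<in>Y. \<bar>v i\<bar>)" and "Y \<subseteq> K"
      using sum_flip flip_K by auto
    show "X = Y"
    proof (rule ccontr)
      assume "X \<noteq> Y"
      with \<open>X \<subseteq> Y\<close> obtain b where "b \<in> Y - X" by blast
      \<comment> \<open>All weights \<open>\<bar>v i\<bar>\<close> on \<open>K\<close> are positive,
        so a proper superset has a larger sum.\<close>
      then have "(\<Sum>i\<in>X. \<bar>v i\<bar>) < (\<Sum>i\<in>Y. \<bar>v i\<bar>)"
        using \<open>X \<subseteq> Y\<close> \<open>Y \<subseteq> K\<close> \<open>finite K\<close> nz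
        by (intro sum_strict_mono2[of Y X b]) (auto intro: finite_subset)
      with eq show False by simp
    qed
  qed (rule \<open>finite K\<close>)
  then show ?thesis
    by (simp add: card_image[OF inj])
qed

text \<open>A zero-sum subset splits into its trace on the support, to which Littlewood-Offord
  applies, and a free choice outside the support.\<close>

lemma card_zero_subset_sums_le:
  fixes v :: "'a \<Rightarrow> 'b::linordered_idom"
  assumes "finite D"
  shows "real (card {A. A \<subseteq> D \<and> sum v A = 0}) \<le> 2 ^ card D / sqrt (card {i \<in> D. v i \<noteq> 0} + 1)"
proof -
  define K where "K = {i \<in> D. v i \<noteq> 0}"
  define k where "k = card K"
  have "K \<subseteq> D" "finite K"
    using assms by (auto simp: K_def)
  let ?Z = "{A. A \<subseteq> D \<and> sum v A = 0}" and ?F = "{A. A \<subseteq> K \<and> sum v A = 0}"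
  let ?f = "\<lambda>A. (A \<inter> K, A - K)"
  have "sum v (A \<inter> K) = sum v A" if "A \<subseteq> D" for A
    using that assms by (intro sum.mono_neutral_left) (auto simp: K_def intro: finite_subset)
  then have "?f ` ?Z \<subseteq> ?F \<times> Pow (D - K)"
    by auto
  moreover have "inj_on ?f ?Z"
    by (auto simp: inj_on_def)
  ultimately have "card ?Z \<le> card (?F \<times> Pow (D - K))"
    using assms \<open>finite K\<close> by (intro card_inj_on_le) auto
  also have "\<dots> = card ?F * 2 ^ (card D - k)"
    using assms \<open>K \<subseteq> D\<close> \<open>finite K\<close>
    by (simp add: card_cartesian_product card_Pow card_Diff_subset k_def)
  also have "\<dots> \<le> (k choose (k div 2)) * 2 ^ (card D - k)"
    unfolding k_def by (intro mult_right_mono littlewood_offord) (auto simp: K_def assms)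
  finally have "real (card ?Z) \<le> real (k choose (k div 2)) * 2 ^ (card D - k)"
    by (metis (no_types, lifting) of_nat_le_iff of_nat_mult of_nat_numeral of_nat_power)
  also have "real (k choose (k div 2)) \<le> 2 ^ k / sqrt (k + 1)"
  proof -
    have "real ((k choose (k div 2))\<^sup>2 * (k + 1)) \<le> real (4 ^ k)"
      using central_binomial_sq_le of_nat_le_iff by blast
    moreover have "(real (k choose (k div 2)) * sqrt (k + 1))\<^sup>2 = real ((k choose (k div 2))\<^sup>2 * (k + 1))"
      by (simp add: algebra_simps)
    moreover have "real (4 ^ k) = (2 ^ k)\<^sup>2"
      by (simp add: power2_eq_square flip: power_mult_distrib)
    ultimately have "(real (k choose (k div 2)) * sqrt (k + 1))\<^sup>2 \<le> (2 ^ k)\<^sup>2"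
      by simp
    then have "real (k choose (k div 2)) * sqrt (k + 1) \<le> 2 ^ k"
      by (rule power2_le_imp_le) simp
    then show ?thesis
      by (simp add: field_simps)
  qed
  also have "2 ^ k / sqrt (k + 1) * 2 ^ (card D - k) = 2 ^ card D / sqrt (real (k + 1))"
    using card_mono[OF assms \<open>K \<subseteq> D\<close>] by (simp add: k_def flip: power_add)
  finally show ?thesis
    by (simp add: k_def K_def mult_right_mono)
qed

section \<open>Union bound for families of subsets\<close>

text \<open>The probabilistic argument in counting form: the \<open>m\<close>-tuples of subsets that
  fail for some \<open>v\<close> are too few to exhaust all \<open>m\<close>-tuples.\<close>

lemma exists_separating_family:
  fixes V :: "('a \<Rightarrow> 'b::comm_monoid_add) set"
  assumes "finite D" and "finite V"
    and less: "(\<Sum>v\<in>V. card {A. A \<subseteq> D \<and> sum v A = 0} ^ m) < (2 ^ card D) ^ m"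
  shows "\<exists>R. (\<forall>i<m. R i \<subseteq> D) \<and> (\<forall>v\<in>V. \<exists>i<m. sum v (R i) \<noteq> 0)"
proof -
  let ?Z = "\<lambda>v. {A. A \<subseteq> D \<and> sum v A = 0}"
  let ?bad = "\<lambda>v. {..<m} \<rightarrow>\<^sub>E ?Z v" and ?all = "{..<m} \<rightarrow>\<^sub>E Pow D"
  have "card (\<Union>v\<in>V. ?bad v) \<le> (\<Sum>v\<in>V. card (?bad v))"
    by (rule card_UN_le) (rule \<open>finite V\<close>)
  also have "\<dots> = (\<Sum>v\<in>V. card (?Z v) ^ m)"
    by (simp add: card_PiE)
  also have "\<dots> < card ?all"
    using less \<open>finite D\<close> by (simp add: card_PiE card_Pow)
  finally have "card (\<Union>v\<in>V. ?bad v) < card ?all" .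
  moreover have "finite (\<Union>v\<in>V. ?bad v)"
    using assms by (auto intro!: finite_PiE)
  ultimately have "\<not> ?all \<subseteq> (\<Union>v\<in>V. ?bad v)"
    using card_mono[of "\<Union>v\<in>V. ?bad v" ?all] by (meson leD)
  then obtain R where R: "R \<in> ?all" and not_bad: "R \<notin> (\<Union>v\<in>V. ?bad v)"
    unfolding subset_iff not_all not_imp by (elim exE conjE)
  have "\<exists>i<m. sum v (R i) \<noteq> 0" if "v \<in> V" for v
  proof -
    have "R \<notin> ?bad v"
      using not_bad UN_I[OF that, of R ?bad] by (rule contrapos_nn)
    then show ?thesis
      using R by (auto simp: PiE_iff)
  qed
  moreover have "\<forall>i<m. R i \<subseteq> D"
    using R by (auto simp: PiE_iff)
  ultimately show ?thesis
    by blast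
qed

section \<open>Histogram differences and their number\<close>

lemma ex_list_of_counts:
  fixes f :: "nat \<Rightarrow> nat"
  shows "\<exists>xs. set xs \<subseteq> {..<d} \<and> length xs = (\<Sum>i<d. f i) \<and> (\<forall>i<d. count_list xs i = f i)"
proof (induction d)
  case 0
  then show ?case by simp
next
  case (Suc d)
  then obtain xs where xs: "set xs \<subseteq> {..<d}" "length xs = (\<Sum>i<d. f i)" "\<forall>i<d. count_list xs i = f i"
    by blast
  have "count_list xs d = 0"
    using xs(1) by (auto simp: count_list_0_iff)
  moreover have "count_list (replicate k d) i = (if i = d then k else 0)" for k i
    by (induction k) auto
  ultimately show ?case
    using xs by (intro exI[of _ "xs @ replicate (f d) d"]) (auto simp: less_Suc_eq)
qed

definition words :: "nat \<Rightarrow> nat \<Rightarrow> nat list set" where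
  "words n d = {xs. set xs \<subseteq> {..<d} \<and> length xs = n}"

definition count_diff :: "'a list \<times> 'a list \<Rightarrow> 'a \<Rightarrow> int" where
  "count_diff = (\<lambda>(xs, ys) i. int (count_list xs i) - int (count_list ys i))"

text \<open>Histograms enter as letter counts of words, so finiteness and the bound
  \<open>d ^ (2 * n)\<close> come from counting pairs of words. Zero is removed because every row
  annihilates it.\<close>

definition histogram_diffs :: "nat \<Rightarrow> nat \<Rightarrow> (nat \<Rightarrow> int) set" where
  "histogram_diffs n d = count_diff ` (words n d \<times> words n d) - {\<lambda>_. 0}"

lemma finite_words [simp]: "finite (words n d)"
  unfolding words_def using finite_lists_length_eq[of "{..<d}" n] by simp

lemma card_words: "card (words n d) = d ^ n"
  unfolding words_def using card_lists_length_eq[of "{..<d}" n] by simp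

lemma finite_histogram_diffs [simp]: "finite (histogram_diffs n d)"
  by (simp add: histogram_diffs_def)

lemma card_histogram_diffs_le: "card (histogram_diffs n d) \<le> d ^ (2 * n)"
proof -
  have "card (histogram_diffs n d) \<le> card (count_diff ` (words n d \<times> words n d))"
    unfolding histogram_diffs_def by (intro card_mono) auto
  also have "\<dots> \<le> card (words n d \<times> words n d)"
    by (intro card_image_le) auto
  finally show ?thesis
    by (simp add: card_words card_cartesian_product power_add mult_2)
qed

lemma histogram_diffs_eq_0: "v \<in> histogram_diffs n d \<Longrightarrow> i \<ge> d \<Longrightarrow> v i = 0"
  by (auto simp: histogram_diffs_def count_diff_def words_def subset_iff simp flip: not_le) (metis count_notin)

lemma abs_histogram_diffs_le:
  assumes "v \<in> histogram_diffs n d" shows "\<bar>v i\<bar> \<le> int n"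
proof -
  obtain xs ys where "length xs = n" "length ys = n" "v = count_diff (xs, ys)"
    using assms by (auto simp: histogram_diffs_def words_def)
  then show ?thesis
    using count_le_length[of xs i] count_le_length[of ys i] by (simp add: count_diff_def)
qed

lemma support_histogram_diffs_nonempty:
  assumes "v \<in> histogram_diffs n d" shows "{i \<in> {..<d}. v i \<noteq> 0} \<noteq> {}"
proof -
  have "v \<noteq> (\<lambda>_. 0)" using assms by (simp add: histogram_diffs_def)
  then obtain i where "v i \<noteq> 0" by auto
  with histogram_diffs_eq_0[OF assms] show ?thesis
    by (metis (mono_tags, lifting) empty_Collect_eq lessThan_iff linorder_not_less)
qed

text \<open>A difference is determined by a list of \<open>K\<close> pairs (index, value) covering
  its support, and each pair has at most \<open>d * (2 * n + 1)\<close> possibilities.\<close>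

lemma card_small_support_histogram_diffs_le:
  "card {v \<in> histogram_diffs n d. card {i \<in> {..<d}. v i \<noteq> 0} \<le> K} \<le> (d * (2 * n + 1)) ^ K"
proof -
  let ?X = "{..<d} \<times> {- int n..int n}"
  let ?L = "{ps. set ps \<subseteq> ?X \<and> length ps = K}"
  \<comment> \<open>Decodes an association list; indices that are not listed get the value
    0.\<close>
  let ?fun = "\<lambda>ps i. case map_of ps i of None \<Rightarrow> 0 | Some a \<Rightarrow> a"
  have "v \<in> ?fun ` ?L" if v: "v \<in> histogram_diffs n d" and small: "card {i \<in> {..<d}. v i \<noteq> 0} \<le> K" for v
  proof -
    define S where "S = {i \<in> {..<d}. v i \<noteq> 0}"
    have "finite S" by (simp add: S_def)
    obtain j where j: "j \<in> S"
      using support_histogram_diffs_nonempty[OF v] unfolding S_def by blast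
    obtain idx where idx: "set idx = S" "distinct idx"
      using finite_distinct_list[OF \<open>finite S\<close>] by blast
    \<comment> \<open>padding with repetitions of one support element, so that all lists have length exactly \<open>K\<close>\<close>
    define js where "js = idx @ replicate (K - card S) j"
    have "set js = S"
      using idx j by (auto simp: js_def)
    moreover have "length js = K"
      using idx small distinct_card[of idx] by (simp add: js_def S_def)
    ultimately have js: "set js = S" "length js = K" .
    let ?ps = "map (\<lambda>i. (i, v i)) js"
    have ps: "?ps \<in> ?L"
      using js abs_histogram_diffs_le[OF v] by (auto simp: S_def abs_le_iff minus_le_iff)
    \<comment> \<open>Repeated keys are harmless, since all copies of an index carry the same
      value.\<close>
    have "v i = ?fun ?ps i" for i
    proof (cases "i \<in> S")
      case True
      then show ?thesis
        by (simp add: map_of_map_restrict js)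
    next
      case False
      then have "v i = 0"
        using histogram_diffs_eq_0[OF v, of i] by (cases "i < d") (auto simp: S_def)
      then show ?thesis
        using False by (simp add: map_of_map_restrict js)
    qed
    then have "v = ?fun ?ps"
      by (rule ext)
    then show ?thesis
      using ps by (rule image_eqI)
  qed
  then have "{v \<in> histogram_diffs n d. card {i \<in> {..<d}. v i \<noteq> 0} \<le> K} \<subseteq> ?fun ` ?L"
    by blast
  moreover have "finite ?L"
    by (intro finite_lists_length_eq) simp
  ultimately have "card {v \<in> histogram_diffs n d. card {i \<in> {..<d}. v i \<noteq> 0} \<le> K} \<le> card ?L"
    by (meson card_image_le card_mono finite_imageI order_trans)
  also have "\<dots> = (d * (2 * n + 1)) ^ K"
    by (subst card_lists_length_eq) (auto simp: card_cartesian_product nat_add_distrib nat_mult_distrib add.commute)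
  finally show ?thesis .
qed

section \<open>From separating families to matrices\<close>

lemma histogram_counts:
  assumes "\<mu> \<in> histograms n d"
  shows "\<exists>xs\<in>words n d. \<forall>i<d. \<mu> $ i = int (count_list xs i)"
proof -
  have \<mu>: "dim_vec \<mu> = d" "\<And>i. i < d \<Longrightarrow> 0 \<le> \<mu> $ i" "(\<Sum>i<d. \<bar>\<mu> $ i\<bar>) = int n"
    using assms by (auto simp: histograms_def l1_norm_def)
  have "int (\<Sum>i<d. nat (\<mu> $ i)) = (\<Sum>i<d. \<bar>\<mu> $ i\<bar>)"
    using \<mu>(2) by simp
  then have "(\<Sum>i<d. nat (\<mu> $ i)) = n"
    using \<mu>(3) by linarith
  then show ?thesis
    using ex_list_of_counts[of d "\<lambda>i. nat (\<mu> $ i)"] \<mu>(2) by (auto simp: words_def)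
qed

text \<open>The indicator vectors of a separating family of subsets serve as rows: equal images
  would make every row annihilate the nonzero difference.\<close>

lemma exists_detecting_matrix:
  assumes less: "(\<Sum>v\<in>histogram_diffs n d. card {A. A \<subseteq> {..<d} \<and> sum v A = 0} ^ m) < (2 ^ d) ^ m"
  shows "\<exists>S\<in>binary_mats m d. \<forall>\<mu>1\<in>histograms n d. \<forall>\<mu>2\<in>histograms n d.
    \<mu>1 \<noteq> \<mu>2 \<longrightarrow> S *\<^sub>v \<mu>1 \<noteq> S *\<^sub>v \<mu>2"
proof -
  obtain R where R: "\<And>i. i < m \<Longrightarrow> R i \<subseteq> {..<d}"
    and sep: "\<And>v. v \<in> histogram_diffs n d \<Longrightarrow> \<exists>i<m. sum v (R i) \<noteq> 0"
    using exists_separating_family[of "{..<d}" "histogram_diffs n d" m, simplified, OF less] by blast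
  define S :: "int mat" where "S = mat m d (\<lambda>(i, j). if j \<in> R i then 1 else 0)"
  have S_mult: "(S *\<^sub>v \<mu>) $ i = (\<Sum>j\<in>R i. \<mu> $ j)" if "i < m" "dim_vec \<mu> = d" for \<mu> i
  proof -
    have "(S *\<^sub>v \<mu>) $ i = (\<Sum>j<d. if j \<in> R i then \<mu> $ j else 0)"
      using that by (auto simp: S_def scalar_prod_def lessThan_atLeast0 intro!: sum.cong)
    also have "\<dots> = (\<Sum>j\<in>R i. \<mu> $ j)"
      using R[OF that(1)] by (intro sum.mono_neutral_cong_right) auto
    finally show ?thesis .
  qed
  have "S *\<^sub>v \<mu>1 \<noteq> S *\<^sub>v \<mu>2"
    if \<mu>: "\<mu>1 \<in> histograms n d" "\<mu>2 \<in> histograms n d" and "\<mu>1 \<noteq> \<mu>2" for \<mu>1 \<mu>2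
  proof
    assume eq: "S *\<^sub>v \<mu>1 = S *\<^sub>v \<mu>2"
    have dim: "dim_vec \<mu>1 = d" "dim_vec \<mu>2 = d"
      using \<mu> by (auto simp: histograms_def)
    obtain xs ys where xs: "xs \<in> words n d" "\<forall>i<d. \<mu>1 $ i = int (count_list xs i)"
      and ys: "ys \<in> words n d" "\<forall>i<d. \<mu>2 $ i = int (count_list ys i)"
      using histogram_counts \<mu> by meson
    let ?v = "count_diff (xs, ys)"
    obtain j where "j < d" "\<mu>1 $ j \<noteq> \<mu>2 $ j"
      using \<open>\<mu>1 \<noteq> \<mu>2\<close> dim by (metis eq_vecI)
    then have "?v j \<noteq> 0"
      using xs(2) ys(2) by (simp add: count_diff_def)
    then have "?v \<noteq> (\<lambda>_. 0)"
      by metis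
    then have "?v \<in> histogram_diffs n d"
      using xs(1) ys(1) by (simp add: histogram_diffs_def)
    then obtain i where i: "i < m" "sum ?v (R i) \<noteq> 0"
      using sep by blast
    have "sum ?v (R i) = (\<Sum>j\<in>R i. \<mu>1 $ j - \<mu>2 $ j)"
      using R[OF i(1)] xs(2) ys(2) by (intro sum.cong) (auto simp: count_diff_def)
    also have "\<dots> = 0"
      using S_mult[OF i(1) dim(1)] S_mult[OF i(1) dim(2)] eq by (simp add: sum_subtractf)
    finally show False
      using i(2) by simp
  qed
  moreover have "S \<in> binary_mats m d"
    by (auto simp: S_def binary_mats_def)
  ultimately show ?thesis
    by blast
qed

section \<open>Estimating the union bound\<close>

text \<open>The sum is split at support size \<open>K\<close>: below it the differences are few,
  above it each of them is unlikely to survive.\<close>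

lemma sum_zero_subsets_power_le:
  assumes "n > 0"
  defines "K \<equiv> nat \<lfloor>sqrt n\<rfloor>"
  shows "(\<Sum>v\<in>histogram_diffs n d. real (card {A. A \<subseteq> {..<d} \<and> sum v A = 0}) ^ m)
    \<le> (2 ^ d) ^ m * (real (d * (2 * n + 1)) ^ K / sqrt 2 ^ m + real d ^ (2 * n) / sqrt (sqrt n) ^ m)"
    (is "sum ?z _ \<le> _")
proof -
  let ?k = "\<lambda>v::nat \<Rightarrow> int. card {i \<in> {..<d}. v i \<noteq> 0}"
  define V1 where "V1 = {v \<in> histogram_diffs n d. ?k v \<le> K}"
  define V2 where "V2 = {v \<in> histogram_diffs n d. \<not> ?k v \<le> K}"
  \<comment> \<open>Used with \<open>a = 2\<close> for small and \<open>a = sqrt n\<close> for large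
    supports.\<close>
  have bound: "?z v \<le> (2 ^ d / sqrt a) ^ m" if "a \<le> ?k v + 1" "a > 0" for v and a :: real
  proof -
    have "real (card {A. A \<subseteq> {..<d} \<and> sum v A = 0}) \<le> 2 ^ d / sqrt (?k v + 1)"
      using card_zero_subset_sums_le[of "{..<d}" v] by simp
    also have "\<dots> \<le> 2 ^ d / sqrt a"
      using that by (intro divide_left_mono) auto
    finally show ?thesis
      by (rule power_mono) simp
  qed
  have "sum ?z V1 \<le> real (card V1) * (2 ^ d / sqrt 2) ^ m"
  proof (rule sum_bounded_above)
    fix v assume "v \<in> V1"
    then have "?k v > 0"
      using support_histogram_diffs_nonempty[of v n d] by (simp add: V1_def card_gt_0_iff)
    then show "?z v \<le> (2 ^ d / sqrt 2) ^ m"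
      by (intro bound) auto
  qed
  also have "\<dots> \<le> real (d * (2 * n + 1)) ^ K * (2 ^ d / sqrt 2) ^ m"
  proof (rule mult_right_mono)
    show "real (card V1) \<le> real (d * (2 * n + 1)) ^ K"
      using card_small_support_histogram_diffs_le[of n d K] unfolding V1_def
      by (simp only: of_nat_le_iff flip: of_nat_power)
  qed simp
  finally have 1: "sum ?z V1 \<le> real (d * (2 * n + 1)) ^ K * (2 ^ d / sqrt 2) ^ m" .
  have "sum ?z V2 \<le> real (card V2) * (2 ^ d / sqrt (sqrt n)) ^ m"
  proof (rule sum_bounded_above)
    fix v assume "v \<in> V2"
    then have "K < ?k v"
      by (simp add: V2_def)
    \<comment> \<open>\<open>K\<close> is the floor of \<open>sqrt n\<close>, so a support larger
      than \<open>K\<close> has size above \<open>sqrt n\<close>.\<close>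
    then have "sqrt n \<le> ?k v + 1"
      unfolding K_def by linarith
    then show "?z v \<le> (2 ^ d / sqrt (sqrt n)) ^ m"
      using \<open>n > 0\<close> by (intro bound) auto
  qed
  also have "\<dots> \<le> real d ^ (2 * n) * (2 ^ d / sqrt (sqrt n)) ^ m"
  proof (rule mult_right_mono)
    have "card V2 \<le> card (histogram_diffs n d)"
      by (intro card_mono) (auto simp: V2_def)
    then have "card V2 \<le> d ^ (2 * n)"
      using card_histogram_diffs_le[of n d] by linarith
    then show "real (card V2) \<le> real d ^ (2 * n)"
      by (simp only: of_nat_le_iff flip: of_nat_power)
  qed simp
  finally have 2: "sum ?z V2 \<le> real d ^ (2 * n) * (2 ^ d / sqrt (sqrt n)) ^ m" .
  have "sum ?z (histogram_diffs n d) = sum ?z (V1 \<union> V2)"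
    by (intro sum.cong) (auto simp: V1_def V2_def)
  also have "\<dots> = sum ?z V1 + sum ?z V2"
    by (intro sum.union_disjoint) (auto simp: V1_def V2_def)
  also have "\<dots> \<le> real (d * (2 * n + 1)) ^ K * (2 ^ d / sqrt 2) ^ m
      + real d ^ (2 * n) * (2 ^ d / sqrt (sqrt n)) ^ m"
    by (rule add_mono[OF 1 2])
  also have "a * (2 ^ d / r) ^ m + b * (2 ^ d / s) ^ m = (2 ^ d) ^ m * (a / r ^ m + b / s ^ m)"
    for a b r s :: real
    by (simp add: power_divide distrib_left mult.commute)
  finally show ?thesis .
qed

lemma less_half_of_ln_less:
  fixes x :: real
  assumes "x > 0" "ln x < - ln 2" shows "x < 1 / 2"
proof -
  have "ln x < ln (1 / 2)"
    using assms(2) by (simp add: ln_div)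
  then show ?thesis
    using assms(1) by simp
qed

lemma ln2_ge_half: "1 / 2 \<le> ln (2::real)"
  using exp_half_le2 ln_ge_iff[of "2::real" "1 / 2"] by simp

text \<open>Both summands are shown to be below 1/2 by comparing logarithms, measured in the unit
  \<open>X\<close> = \<open>n * ln d / ln n\<close>.\<close>

lemma union_bound_less_1:
  fixes n d m :: nat
  assumes n: "n \<ge> 2" and d: "d \<ge> 2" and m: "real m \<ge> 600 * (n * ln d / ln n)"
  shows "real (d * (2 * n + 1)) ^ nat \<lfloor>sqrt n\<rfloor> / sqrt 2 ^ m + real d ^ (2 * n) / sqrt (sqrt n) ^ m < 1"
proof -
  define K where "K = nat \<lfloor>sqrt n\<rfloor>"
  define t where "t = sqrt n"
  define L where "L = ln (real n)"
  define D where "D = ln (real d)"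
  define X where "X = n * D / L"
  have ln2: "1 / 2 \<le> ln (2::real)" "ln (2::real) \<le> 1"
    using ln2_ge_half ln_le_minus_one[of "2::real"] by auto
  have "ln 2 \<le> L" "ln 2 \<le> D"
    using n d by (simp_all add: L_def D_def)
  then have L: "1 / 2 \<le> L" and D: "1 / 2 \<le> D"
    using ln2 by linarith+
  have t: "t\<^sup>2 = n" "t > 0" "K \<le> t"
    using n by (auto simp: t_def K_def)
  have "L \<le> n"
    using ln_le_minus_one[of "real n"] n by (simp add: L_def)
  then have "L * 1 \<le> n * (2 * D)"
    using L D by (intro mult_mono) auto
  then have X: "1 / 2 \<le> X"
    using L by (simp add: X_def field_simps)
  have mX: "600 * X \<le> m"
    using m by (simp add: X_def D_def L_def)
  \<comment> \<open>Apply \<open>ln x \<le> x\<close> to the fourth root of \<open>n\<close>. This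
    later absorbs the logarithms: \<open>t * D * L\<close> is at most \<open>16 * n * D / L\<close>
    = \<open>16 * X\<close>.\<close>
  have L2: "L\<^sup>2 \<le> 16 * t"
  proof -
    have "L = 4 * ln (sqrt t)"
      using n by (simp add: L_def t_def ln_sqrt)
    also have "\<dots> \<le> 4 * sqrt t"
      using ln_le_minus_one[of "sqrt t"] t(2) by simp
    finally have "L\<^sup>2 \<le> (4 * sqrt t)\<^sup>2"
      using L by (intro power_mono) auto
    then show ?thesis
      using t(2) by (simp add: power_mult_distrib)
  qed
  have "ln (d * (2 * n + 1)) \<le> 8 * (D * L)"
  proof -
    have "2 * n + 1 \<le> n ^ 3"
    proof -
      have "2 * n + 1 \<le> 4 * n" using n by simp
      also have "\<dots> \<le> (n * n) * n"
        using mult_le_mono[OF n n] by (intro mult_le_mono1) simp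
      finally show ?thesis by (simp add: power3_eq_cube)
    qed
    then have "real (2 * n + 1) \<le> real n ^ 3"
      by (simp only: of_nat_le_iff flip: of_nat_power)
    then have "ln (real (2 * n + 1)) \<le> ln (real n ^ 3)"
      using n by (intro ln_mono) auto
    also have "\<dots> = 3 * L"
      using n by (simp add: L_def ln_realpow)
    finally have "ln (d * (2 * n + 1)) \<le> D + 3 * L"
      using d ln_mult_pos[of "real d" "real (2 * n + 1)"] unfolding of_nat_mult D_def by simp
    also have "\<dots> \<le> 8 * (D * L)"
    proof -
      \<comment> \<open>Since \<open>L\<close> and \<open>D\<close> are at least 1/2,
        \<open>D + 3 * L\<close> is at most \<open>2 * (D * L) + 6 * (D * L)\<close>.\<close>
      have "D * 1 \<le> D * (2 * L)" "1 * L \<le> (2 * D) * L"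
        using L D by (intro mult_left_mono mult_right_mono; simp)+
      then show ?thesis by simp
    qed
    finally show ?thesis .
  qed
  then have "K * ln (d * (2 * n + 1)) \<le> K * (8 * (D * L))"
    by (rule mult_left_mono) simp
  also have "\<dots> \<le> t * (8 * (D * L))"
    using t D L by (intro mult_right_mono) auto
  also have "\<dots> \<le> 128 * X"
  proof -
    have "t * (8 * (D * L)) * L = 8 * (t * D) * L\<^sup>2"
      by (simp add: power2_eq_square)
    also have "\<dots> \<le> 8 * (t * D) * (16 * t)"
      using L2 t D by (intro mult_left_mono) auto
    also have "\<dots> = 128 * (n * D)"
      by (simp add: power2_eq_square flip: t(1))
    finally show ?thesis
      using L by (simp add: X_def field_simps)
  qed
  finally have K_ln: "K * ln (d * (2 * n + 1)) \<le> 128 * X" .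
  have "real (d * (2 * n + 1)) ^ K / sqrt 2 ^ m < 1 / 2"
  proof (rule less_half_of_ln_less)
    have "ln (real (d * (2 * n + 1)) ^ K / sqrt 2 ^ m) = K * ln (d * (2 * n + 1)) - m * (ln 2 / 2)"
      using d by (simp add: ln_div ln_realpow ln_sqrt del: of_nat_mult)
    \<comment> \<open>The result is \<open>- 22 * X\<close>, at most -11 because
      \<open>X \<ge> 1 / 2\<close>.\<close>
    also have "\<dots> \<le> 128 * X - 600 * X * (1 / 4)"
    proof (rule diff_mono[OF K_ln])
      show "600 * X * (1 / 4) \<le> m * (ln 2 / 2)"
        using mX ln2 by (intro mult_mono) auto
    qed
    also have "\<dots> < - ln 2"
      using X ln2 by simp
    finally show "ln (real (d * (2 * n + 1)) ^ K / sqrt 2 ^ m) < - ln 2" .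
  next
    have "0 < d * (2 * n + 1)"
      using d by simp
    then show "0 < real (d * (2 * n + 1)) ^ K / sqrt 2 ^ m"
      by (intro divide_pos_pos zero_less_power) (simp_all only: of_nat_0_less_iff real_sqrt_gt_0_iff zero_less_numeral)
  qed
  moreover have "real d ^ (2 * n) / sqrt (sqrt n) ^ m < 1 / 2"
  proof (rule less_half_of_ln_less)
    have "ln (real d ^ (2 * n) / sqrt (sqrt n) ^ m) = 2 * (n * D) - m * L / 4"
      using d n by (simp add: ln_div ln_realpow ln_sqrt D_def L_def)
    \<comment> \<open>By \<open>mX\<close>, \<open>m * L\<close> is at least
      \<open>600 * (n * D)\<close>, which leaves \<open>- 148 * (n * D)\<close>.\<close>
    also have "\<dots> \<le> 2 * (n * D) - 600 * (n * D) / 4"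
      using mX L by (simp add: X_def field_simps)
    also have "\<dots> < - ln 2"
    proof -
      have "2 * (1 / 2) \<le> n * D"
        using n D by (intro mult_mono) auto
      then show ?thesis using ln2 by linarith
    qed
    finally show "ln (real d ^ (2 * n) / sqrt (sqrt n) ^ m) < - ln 2" .
  qed (use d n in simp)
  ultimately show ?thesis
    unfolding K_def by linarith
qed

section \<open>Choice of the constant and of the number of rows\<close>

theorem theorem4p2:
  shows "\<exists>C::real. C > 0 \<and>
    (\<forall>n d :: nat. n \<ge> 2 \<and> d \<ge> 2 \<longrightarrow>
      (\<exists>m :: nat. \<exists>S \<in> binary_mats m d.
         m > 0 \<and> real m \<le> C * (real n * ln (real d) / ln (real n)) \<and>
         (\<forall>\<mu>1 \<in> histograms n d. \<forall>\<mu>2 \<in> histograms n d.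
            \<mu>1 \<noteq> \<mu>2 \<longrightarrow> S *\<^sub>v \<mu>1 \<noteq> S *\<^sub>v \<mu>2)))"
\<comment> \<open>The union bound needs \<open>m \<ge> 600 * X\<close>. The extra
  \<open>2 * X\<close> is at least 1 and pays for rounding down in \<open>m\<close>.\<close>
proof (intro exI[of _ "602::real"] conjI allI impI)
  fix n d :: nat
  assume nd: "n \<ge> 2 \<and> d \<ge> 2"
  define X where "X = real n * ln (real d) / ln (real n)"
  define m where "m = nat \<lfloor>602 * X\<rfloor>"
  have X: "1 / 2 \<le> X"
  proof -
    have "1 / 2 \<le> ln (real d)"
      using nd ln2_ge_half ln_mono[of 2 "real d"] by linarith
    moreover have "0 < ln (real n)" "ln (real n) \<le> n"
      using nd ln_le_minus_one[of "real n"] by auto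
    moreover from calculation have "ln (real n) * (1 / 2) \<le> n * ln (real d)"
      by (intro mult_mono) auto
    ultimately show ?thesis
      by (simp add: X_def field_simps)
  qed
  have m: "600 * X \<le> m" "m \<le> 602 * X"
    using X unfolding m_def by linarith+
  have "real (\<Sum>v\<in>histogram_diffs n d. card {A. A \<subseteq> {..<d} \<and> sum v A = 0} ^ m)
      \<le> (2 ^ d) ^ m * (real (d * (2 * n + 1)) ^ nat \<lfloor>sqrt n\<rfloor> / sqrt 2 ^ m + real d ^ (2 * n) / sqrt (sqrt n) ^ m)"
    using sum_zero_subsets_power_le[of n d m] nd by simp
  also have "\<dots> < (2 ^ d) ^ m * 1"
    using union_bound_less_1[of n d m] nd m(1) by (intro mult_strict_left_mono) (auto simp: X_def)
  also have "\<dots> = real ((2 ^ d) ^ m)"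
    by simp
  finally have "(\<Sum>v\<in>histogram_diffs n d. card {A. A \<subseteq> {..<d} \<and> sum v A = 0} ^ m) < (2 ^ d) ^ m"
    by (simp only: of_nat_less_iff)
  then obtain S where "S \<in> binary_mats m d"
    "\<forall>\<mu>1\<in>histograms n d. \<forall>\<mu>2\<in>histograms n d. \<mu>1 \<noteq> \<mu>2 \<longrightarrow> S *\<^sub>v \<mu>1 \<noteq> S *\<^sub>v \<mu>2"
    using exists_detecting_matrix by blast
  moreover have "m > 0"
    using m(1) X by simp
  ultimately show "\<exists>m. \<exists>S\<in>binary_mats m d. m > 0 \<and> real m \<le> 602 * (real n * ln (real d) / ln (real n)) \<and>
      (\<forall>\<mu>1\<in>histograms n d. \<forall>\<mu>2\<in>histograms n d. \<mu>1 \<noteq> \<mu>2 \<longrightarrow> S *\<^sub>v \<mu>1 \<noteq> S *\<^sub>v \<mu>2)"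
    using m(2) unfolding X_def by blast
qed simp

end
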